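(* Let $n\ge 2$ be an integer, let $t\in\mathbb{Z}\setminus\{0\}$, and let $P(x)=c_0+c_1x+\ldots+c_dx^d\in\mathbb{Z}[x]$ be a polynomial such that $$c_0=(-t)^n\quad\text{and}\quad x^dP\big((-t)^{n-1}x^{-1}\big)=C\cdot P(x)\ \text{ for some non-zero constant } C.$$ Let $(x_0,\ldots,x_{n-1})$ be an integer $n$-tuple such that all its terms are coprime with $t$. If the value $K^{(t)}_n(x_0,\ldots,x_{n-1})$ divides $P\big(K^{(t)}_{n-1}(x_1,\ldots,x_{n-1})\big)$, then there exists $x_n\in\mathbb{Z}$ such that $$P\big(K^{(t)}_{n-1}(x_1,\ldots,x_{n-1})\big)=K^{(t)}_n(x_0,\ldots,x_{n-1})\,K^{(t)}_n(x_1,\ldots,x_n).$$ Moreover, this value $x_n$ is unique, provided that $K^{(t)}_{n-1}(x_1,\ldots,x_{n-1})\neq 0$.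
   Context: For $t\in\mathbb{Z}\setminus\{0\}$ the generalised continuants $K^{(t)}_k$ are the polynomials in $k$ variables defined by $K^{(t)}_0():=1$, $K^{(t)}_1(x_1):=x_1$ and $$K^{(t)}_{k+1}(x_1,\ldots,x_{k+1})=x_{k+1}K^{(t)}_k(x_1,\ldots,x_k)+t\,K^{(t)}_{k-1}(x_1,\ldots,x_{k-1}).$$
   Formalization: Uniqueness of x_n is claimed only when K_n(x_0,…,x_{n-1}) is also non-zero; if it is 0 (0 dividing 0), every x_n works, e.g. n=2, t=-1, x_0=x_1=1, P=(1-x)^2. *)

theory Defs
  imports Complex_Main "HOL-Computational_Algebra.Polynomial"
begin

text \<open>
  A list of length \<open>k\<close> represents the arguments \<open>(x\<^sub>1, \<dots>, x\<^sub>k)\<close> of the generalised continuant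
  \<open>K\<^sub>k\<close>. The defining recurrence peels off the last argument, so the recursion runs over
  the reversed list.
\<close>

fun continuant_rev :: "int \<Rightarrow> int list \<Rightarrow> int" where
  "continuant_rev t [] = 1"
| "continuant_rev t [x] = x"
| "continuant_rev t (x # y # ys) = x * continuant_rev t (y # ys) + t * continuant_rev t ys"

definition continuant :: "int \<Rightarrow> int list \<Rightarrow> int" where
  "continuant t xs = continuant_rev t (rev xs)"

lemma continuant_Nil: "continuant t [] = 1"
  by (simp add: continuant_def)

lemma continuant_single: "continuant t [x] = x"
  by (simp add: continuant_def)

lemma continuant_snoc:
  "continuant t (xs @ [x, y]) = y * continuant t (xs @ [x]) + t * continuant t xs"
  by (simp add: continuant_def)

end

theory Submission
  imports Defs
begin

text \<open>
  Write \<open>A = K\<^sub>n(x\<^sub>0, \<dots>, x\<^sub>n\<^sub>-\<^sub>1)\<close>, \<open>B = K\<^sub>n\<^sub>-\<^sub>1(x\<^sub>1, \<dots>, x\<^sub>n\<^sub>-\<^sub>1)\<close> and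
  \<open>B' = K\<^sub>n\<^sub>-\<^sub>2(x\<^sub>1, \<dots>, x\<^sub>n\<^sub>-\<^sub>2)\<close>, and let \<open>P(B) = A m\<close>. By the recurrence
  \<open>K\<^sub>n(x\<^sub>1, \<dots>, x\<^sub>n) = x\<^sub>n B + t B'\<close>, so a solution \<open>x\<^sub>n\<close> exists as soon as \<open>B\<close> divides \<open>m - t B'\<close>.

  The link between \<open>A\<close>, \<open>B\<close> and \<open>B'\<close> is a determinant: the recurrence is multiplication by a
  matrix of determinant \<open>-t\<close>, which gives \<open>A B' \<equiv> t (-t)\<^sup>n\<^sup>-\<^sup>2\<close> modulo \<open>B\<close>
  (\<open>continuant_determinant\<close>). Since also \<open>A m = P(B) \<equiv> P(0) = (-t)\<^sup>n\<close> modulo \<open>B\<close>, the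
  numbers \<open>A m\<close> and \<open>A t B'\<close> agree modulo \<open>B\<close>, and it remains to cancel \<open>A\<close>. This is where
  coprimality with \<open>t\<close> enters: modulo \<open>t\<close> a continuant is the product of its arguments, hence
  \<open>A\<close> is coprime to \<open>t\<close> (\<open>coprime_continuant\<close>), while the determinant shows that any common
  divisor of \<open>A\<close> and \<open>B\<close> divides a power of \<open>t\<close> (\<open>coprime_continuant_tail\<close>).

  When \<open>A\<close> and \<open>B\<close> are both non-zero, the right-hand side is an injective function of \<open>x\<^sub>n\<close>,
  which gives uniqueness.
\<close>

text \<open>
  Expanding both continuants that contain the argument \<open>z\<close> cancels the terms in \<open>z\<close> and
  leaves \<open>-t\<close> times the same expression for a list shorter by one element.
\<close>

lemma continuant_rev_determinant:
  "continuant_rev t (z # zs @ [a]) * continuant_rev t zs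
     - continuant_rev t (z # zs) * continuant_rev t (zs @ [a]) = t * (- t) ^ length zs"
proof (induction zs arbitrary: z)
  case Nil
  then show ?case by simp
next
  case (Cons w ws)
  have "continuant_rev t (z # (w # ws) @ [a]) * continuant_rev t (w # ws)
     - continuant_rev t (z # w # ws) * continuant_rev t ((w # ws) @ [a])
    = - t * (continuant_rev t (w # ws @ [a]) * continuant_rev t ws
     - continuant_rev t (w # ws) * continuant_rev t (ws @ [a]))"
    by (simp add: algebra_simps)
  also have "\<dots> = t * (- t) ^ length (w # ws)"
    using Cons.IH[of w] by simp
  finally show ?case .
qed

lemma continuant_determinant:
  "continuant t (a # xs @ [z]) * continuant t xs
     - continuant t (xs @ [z]) * continuant t (a # xs) = t * (- t) ^ length xs"
  using continuant_rev_determinant[of t z "rev xs" a] by (simp add: continuant_def)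

text \<open>Modulo \<open>t\<close> the second term of the recurrence vanishes, so only products of arguments survive.\<close>

lemma coprime_continuant:
  assumes "\<forall>u\<in>set xs. coprime u t"
  shows "coprime (continuant t xs) t"
proof -
  have "coprime (continuant_rev t ys) t" if "\<forall>u\<in>set ys. coprime u t" for ys
    using that
  proof (induction t ys rule: continuant_rev.induct)
    case (3 t u v ys)
    have "coprime (u * continuant_rev t (v # ys)) t"
      using 3 by simp
    then have "coprime (u * continuant_rev t (v # ys) + t * continuant_rev t ys) t"
      by (simp add: coprime_iff_gcd_eq_1 gcd.commute[of _ t] gcd_add_mult mult.commute[of t] add.commute)
    then show ?case by simp
  qed simp_all
  from this[of "rev xs"] assms show ?thesis by (simp add: continuant_def)
qed

lemma coprime_continuant_tail:
  assumes "\<forall>u\<in>set (a # xs @ [z]). coprime u t"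
  shows "coprime (continuant t (a # xs @ [z])) (continuant t (xs @ [z]))"
proof (rule coprimeI)
  fix e
  assume eA: "e dvd continuant t (a # xs @ [z])" and eB: "e dvd continuant t (xs @ [z])"
  have "e dvd t * (- t) ^ length xs"
    unfolding continuant_determinant[of t a xs z, symmetric] using eA eB by simp
  moreover have "coprime (continuant t (a # xs @ [z])) (t * (- t) ^ length xs)"
    using coprime_continuant[OF assms] by simp
  ultimately show "is_unit e"
    using eA by (meson coprime_common_divisor)
qed

lemma dvd_poly_minus_coeff_0:
  fixes p :: "'a :: comm_ring_1 poly"
  shows "b dvd poly p b - coeff p 0"
  by (cases p) simp

text \<open>
  The completing argument is \<open>y = (m - t B') / B\<close>. The exponent of \<open>-t\<close> in \<open>p(0)\<close> is what makes
  this a division without remainder: \<open>t\<close> times the determinant is exactly \<open>p(0)\<close>, so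
  \<open>A m\<close> and \<open>A t B'\<close> agree modulo \<open>B\<close>. If \<open>B = 0\<close>, then \<open>A\<close>, being coprime to \<open>B\<close>, is a unit;
  hence \<open>m = t B'\<close> and any \<open>y\<close> works.
\<close>

lemma ex_continuant_completion:
  assumes cop: "\<forall>u\<in>set (a # xs @ [z]). coprime u t"
    and p0: "coeff p 0 = (- t) ^ (length xs + 2)"
    and dvd: "continuant t (a # xs @ [z]) dvd poly p (continuant t (xs @ [z]))"
  shows "\<exists>y. poly p (continuant t (xs @ [z]))
    = continuant t (a # xs @ [z]) * continuant t (xs @ [z, y])"
proof -
  define A where "A = continuant t (a # xs @ [z])"
  define B where "B = continuant t (xs @ [z])"
  define B' where "B' = continuant t xs"
  obtain m where m: "poly p B = A * m"
    using dvd unfolding A_def B_def by (elim dvdE)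
  have det: "A * B' = B * continuant t (a # xs) + t * (- t) ^ length xs"
    using continuant_determinant[of t a xs z] by (simp add: A_def B_def B'_def algebra_simps)
  have "A * (m - t * B') = poly p B - t * (A * B')"
    by (simp add: m algebra_simps)
  also have "\<dots> = (poly p B - coeff p 0) - B * (t * continuant t (a # xs))"
    unfolding det p0 by (simp add: algebra_simps)
  finally have "A * (m - t * B') = (poly p B - coeff p 0) - B * (t * continuant t (a # xs))" .
  then have "B dvd A * (m - t * B')"
    by (simp add: dvd_poly_minus_coeff_0)
  moreover have "coprime B A"
    using coprime_continuant_tail[OF cop] by (simp add: A_def B_def coprime_commute)
  ultimately have "B dvd m - t * B'"
    by (simp add: coprime_dvd_mult_right_iff)
  then obtain y where y: "m - t * B' = B * y" by (elim dvdE)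
  have "continuant t (xs @ [z, y]) = m"
    unfolding continuant_snoc using y by (simp add: B_def B'_def algebra_simps)
  then show ?thesis using m by (auto simp: A_def B_def)
qed

theorem theorem2:
  fixes n d :: nat and t :: int and P :: "int poly" and x :: "nat \<Rightarrow> int"
  assumes "n \<ge> 2"
    and "t \<noteq> 0"
    and "degree P \<le> d"
    and "coeff P 0 = (- t) ^ n"
    and "\<exists>C::complex. C \<noteq> 0 \<and> (\<forall>z::complex. z \<noteq> 0 \<longrightarrow>
           z ^ d * poly (map_poly of_int P) (of_int ((- t) ^ (n - 1)) * inverse z)
             = C * poly (map_poly of_int P) z)"
    and "\<forall>i<n. coprime (x i) t"
    and "continuant t (map x [0..<n]) dvd poly P (continuant t (map x [1..<n]))"
  shows "(\<exists>y::int. poly P (continuant t (map x [1..<n]))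
            = continuant t (map x [0..<n]) * continuant t (map x [1..<n] @ [y]))
       \<and> (continuant t (map x [0..<n]) \<noteq> 0 \<longrightarrow> continuant t (map x [1..<n]) \<noteq> 0 \<longrightarrow>
           (\<exists>!y::int. poly P (continuant t (map x [1..<n]))
             = continuant t (map x [0..<n]) * continuant t (map x [1..<n] @ [y])))"
proof -
  define xs where "xs = map x [1..<n - 1]"
  have tail: "map x [1..<n] = xs @ [x (n - 1)]"
    using assms(1) upt_Suc_append[of 1 "n - 1"] by (simp add: xs_def)
  have full: "map x [0..<n] = x 0 # xs @ [x (n - 1)]"
    using assms(1) tail upt_conv_Cons[of 0 n] by simp
  have len: "length xs + 2 = n"
    using assms(1) by (simp add: xs_def)
  have "\<forall>u\<in>set (map x [0..<n]). coprime u t"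
    using assms(6) by auto
  then have ex: "\<exists>y. poly P (continuant t (map x [1..<n]))
      = continuant t (map x [0..<n]) * continuant t (map x [1..<n] @ [y])"
    using ex_continuant_completion[of "x 0" xs "x (n - 1)" t P] assms(4,7)
    unfolding tail full len by simp
  have inj: "y = y'"
    if "continuant t (map x [0..<n]) * continuant t (map x [1..<n] @ [y])
        = continuant t (map x [0..<n]) * continuant t (map x [1..<n] @ [y'])"
      and "continuant t (map x [0..<n]) \<noteq> 0" and "continuant t (map x [1..<n]) \<noteq> 0" for y y'
    using that unfolding tail by (simp add: continuant_snoc)
  show ?thesis
    using ex inj by metis
qed

end
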